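(* Let $\mathbf{s}^m=(s^m_1,\ldots,s^m_d)$, $m=1,\ldots,M$, be elliptically symmetric sources of the ISA model with finite covariances. Then for every $m$: $$H\left(\sum_{i=1}^d w_i s^m_i\right)\ \ge\ \sum_{i=1}^d w_i^2\,H(s^m_i)\qquad\text{for all }\mathbf{w}\in S^d ,$$ and moreover $$e^{2H\left(\sum_{i=1}^d w_i s^m_i\right)}\ =\ \sum_{i=1}^d e^{2H(w_i s^m_i)}\qquad\text{for all }\mathbf{w}\in S^d .$$
   Context: $S^d:=\{\mathbf{w}\in\mathbb{R}^d:\|\mathbf{w}\|=1\}$ (Euclidean norm). $H$ denotes Shannon's differential entropy with natural logarithm; convention: if $w_i=0$ then $H(w_is^m_i)=-\infty$ and $e^{2H(w_is^m_i)}=0$. A random vector $\mathbf{v}\in\mathbb{R}^d$ is spherically symmetric around $\mathbf{0}$ if $\mathbf{v}$ and $\mathbf{O}\mathbf{v}$ have the same distribution for every orthogonal $\mathbf{O}\in\mathbb{R}^{d\times d}$. A random vector $\mathbf{e}\in\mathbb{R}^d$ is elliptically symmetric (around $\boldsymbol{\mu}$) if $\mathbf{e}=\boldsymbol{\mu}+\boldsymbol{\Lambda}\mathbf{v}$ for some $\boldsymbol{\mu}\in\mathbb{R}^d$, some invertible $\boldsymbol{\Lambda}\in\mathbb{R}^{d\times d}$ and some $\mathbf{v}$ spherically symmetric around $\mathbf{0}$. ISA (Independent Subspace Analysis) sources: $\mathbf{s}^1,\ldots,\mathbf{s}^M$ are mutually independent random vectors in $\mathbb{R}^d$ having densities, with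 finite entropies of their coordinates, and they are white: $E[\mathbf{s}^m]=\mathbf{0}$, $E[\mathbf{s}^m(\mathbf{s}^m)^T]=\mathbf{I}_d$ for every $m$. *)

theory Defs
  imports "HOL-Probability.Probability"
begin

section \<open>Differential entropy with values in the extended reals\<close>

text \<open>
  With base \<open>exp 1\<close> the function \<open>entropy_density (exp 1) lborel (distr P lborel X)\<close> is \<open>ln f\<close>,
  where \<open>f\<close> is the Lebesgue density of \<open>X\<close>. The library constant \<open>prob_space.entropy\<close> is
  real-valued, and its integral defaults to 0 when it does not converge. Here the positive and
  negative parts of \<open>E[- ln f(X)]\<close> are integrated separately, and a law that is not absolutely
  continuous gets entropy \<open>-\<infinity>\<close>. This includes the law of the constant 0, which gives the convention
  for \<open>w\<^sub>i = 0\<close> (lemma \<open>diff_entropy_const\<close>). Since \<open>\<infinity> - \<infinity> = \<infinity>\<close> in \<^typ>\<open>ereal\<close>, the value is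
  finite exactly when the law is absolutely continuous and both parts are finite.
\<close>

definition diff_entropy :: "'a measure \<Rightarrow> ('a \<Rightarrow> real) \<Rightarrow> ereal" where
  "diff_entropy P X =
    (let D = distr P lborel X; g = entropy_density (exp 1) lborel D in
     if absolutely_continuous lborel D
     then enn2ereal (\<integral>\<^sup>+ x. ennreal (- g x) \<partial>D) - enn2ereal (\<integral>\<^sup>+ x. ennreal (g x) \<partial>D)
     else - \<infinity>)"

definition exp_ereal :: "ereal \<Rightarrow> ereal" where
  "exp_ereal x = (case x of ereal r \<Rightarrow> ereal (exp r) | PInfty \<Rightarrow> \<infinity> | MInfty \<Rightarrow> 0)"

lemma exp_ereal_simps [simp]:
  "exp_ereal (ereal r) = ereal (exp r)" "exp_ereal \<infinity> = \<infinity>" "exp_ereal (- \<infinity>) = 0"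
  by (simp_all add: exp_ereal_def)

lemma diff_entropy_eq_entropy:
  assumes "prob_space P"
    and "absolutely_continuous lborel (distr P lborel X)"
    and int: "integrable (distr P lborel X) (entropy_density (exp 1) lborel (distr P lborel X))"
  shows "diff_entropy P X = ereal (prob_space.entropy P (exp 1) lborel X)"
proof -
  let ?D = "distr P lborel X"
  let ?g = "entropy_density (exp 1) lborel ?D"
  let ?p = "\<integral>\<^sup>+ x. ennreal (?g x) \<partial>?D" and ?n = "\<integral>\<^sup>+ x. ennreal (- ?g x) \<partial>?D"
  have fin: "?p \<noteq> \<infinity>" "?n \<noteq> \<infinity>"
    using int by (auto simp: real_integrable_def)
  obtain p n where pn: "?p = ennreal p" "?n = ennreal n" "0 \<le> p" "0 \<le> n"
    using fin by (metis ennreal_cases infinity_ennreal_def)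
  have "integral\<^sup>L ?D ?g = p - n"
    using real_lebesgue_integral_def[OF int] pn by simp
  then show ?thesis
    using assms(2) pn
    by (simp add: diff_entropy_def Let_def prob_space.entropy_def[OF assms(1)] KL_divergence_def
        enn2ereal_ennreal)
qed

lemma diff_entropy_distributed:
  assumes "prob_space P" and X: "distributed P lborel X (\<lambda>x. ennreal (f x))"
    and nn: "\<And>x. 0 \<le> f x" and int: "integrable lborel (\<lambda>x. f x * ln (f x))"
  shows "diff_entropy P X = ereal (- (\<integral>x. f x * ln (f x) \<partial>lborel))"
proof -
  interpret information_space P "exp 1"
    using assms(1) by (simp add: information_space_def information_space_axioms_def)
  have [measurable]: "f \<in> borel_measurable lborel"
    using distributed_real_measurable[OF _ X] nn by simp
  have D: "distr P lborel X = density lborel (\<lambda>x. ennreal (f x))"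
    using X by (rule distributed_distr_eq_density)
  have ae: "AE x in lborel. RN_deriv lborel (distr P lborel X) x = ennreal (f x)"
    unfolding D by (rule distributed_RN_deriv[OF X])
  have "integrable (distr P lborel X) (\<lambda>x. ln (f x))"
    unfolding D using int nn by (subst integrable_density) auto
  moreover have "AE x in distr P lborel X.
      ln (f x) = entropy_density (exp 1) lborel (distr P lborel X) x"
    unfolding D using ae[unfolded D] nn
    by (auto simp: AE_density entropy_density_def log_def)
  ultimately have "integrable (distr P lborel X)
      (entropy_density (exp 1) lborel (distr P lborel X))"
    by (subst integrable_cong_AE[symmetric]) auto
  moreover have "absolutely_continuous lborel (distr P lborel X)"
    unfolding D by (rule absolutely_continuousI_density) simp
  moreover have "entropy (exp 1) lborel X = - (\<integral>x. f x * log (exp 1) (f x) \<partial>lborel)"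
    using entropy_distr[OF X] nn by simp
  ultimately show ?thesis
    using diff_entropy_eq_entropy[OF assms(1)] by (simp add: log_def)
qed

lemma diff_entropy_const:
  assumes "prob_space P"
  shows "diff_entropy P (\<lambda>\<omega>. c) = - \<infinity>"
proof -
  interpret prob_space P by fact
  have "emeasure (distr P lborel (\<lambda>\<omega>. c)) {c} = emeasure P (space P)"
    by (subst emeasure_distr) auto
  then have "{c} \<notin> null_sets (distr P lborel (\<lambda>\<omega>. c))"
    using emeasure_space_1 by (auto simp: null_sets_def)
  moreover have "{c} \<in> null_sets lborel"
    by (auto simp: null_sets_def)
  ultimately have "\<not> absolutely_continuous lborel (distr P lborel (\<lambda>\<omega>. c))"
    unfolding absolutely_continuous_def by blast
  then show ?thesis
    unfolding diff_entropy_def Let_def by (rule if_not_P)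
qed


section \<open>Symmetric random vectors and white independent subspace sources\<close>

definition spherically_symmetric :: "'a measure \<Rightarrow> ('a \<Rightarrow> real ^ 'd) \<Rightarrow> bool" where
  "spherically_symmetric P v \<longleftrightarrow>
     v \<in> borel_measurable P \<and>
     (\<forall>Q :: real ^ 'd ^ 'd. orthogonal_matrix Q \<longrightarrow>
        distr P borel (\<lambda>\<omega>. Q *v v \<omega>) = distr P borel v)"

definition elliptically_symmetric :: "'a measure \<Rightarrow> ('a \<Rightarrow> real ^ 'd) \<Rightarrow> bool" where
  "elliptically_symmetric P e \<longleftrightarrow>
     (\<exists>(\<mu> :: real ^ 'd) (\<Lambda> :: real ^ 'd ^ 'd) v.
        invertible \<Lambda> \<and> spherically_symmetric P v \<and> (\<forall>\<omega>\<in>space P. e \<omega> = \<mu> + \<Lambda> *v v \<omega>))"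

definition white :: "'a measure \<Rightarrow> ('a \<Rightarrow> real ^ 'd) \<Rightarrow> bool" where
  "white P X \<longleftrightarrow>
     integrable P X \<and> (\<integral>\<omega>. X \<omega> \<partial>P) = 0 \<and>
     integrable P (\<lambda>\<omega>. (\<chi> i j. X \<omega> $ i * X \<omega> $ j) :: real ^ 'd ^ 'd) \<and>
     (\<integral>\<omega>. ((\<chi> i j. X \<omega> $ i * X \<omega> $ j) :: real ^ 'd ^ 'd) \<partial>P) = mat 1"

definition ISA_sources :: "'a measure \<Rightarrow> nat \<Rightarrow> (nat \<Rightarrow> 'a \<Rightarrow> real ^ 'd) \<Rightarrow> bool" where
  "ISA_sources P M s \<longleftrightarrow>
     prob_space.indep_vars P (\<lambda>_. borel) s {1..M} \<and>
     (\<forall>m\<in>{1..M}.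
        (\<exists>f. distributed P lborel (s m) f) \<and>
        (\<forall>i. \<bar>diff_entropy P (\<lambda>\<omega>. s m \<omega> $ i)\<bar> \<noteq> \<infinity>) \<and>
        white P (s m))"

end

theory Submission
  imports Defs
begin

text \<open>
  Write a source as \<open>e = \<mu> + \<Lambda> v\<close> with \<open>v\<close> spherical. Then \<open>w \<bullet> e = w \<bullet> \<mu> + (\<Lambda>\<^sup>T w) \<bullet> v\<close>,
  and the law of \<open>u \<bullet> v\<close> depends only on \<open>\<parallel>u\<parallel>\<close>. Whiteness forces \<open>w \<bullet> \<mu> = 0\<close> and makes
  \<open>\<parallel>\<Lambda>\<^sup>T w\<parallel>\<close> the same for all unit vectors \<open>w\<close>, so all one-dimensional projections of \<open>e\<close> have one
  common law, with entropy \<open>h\<close>. Both claims then reduce to \<open>\<Sum> w\<^sub>i\<^sup>2 = 1\<close>, the second through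
  \<open>H (c X) = H X + ln \<bar>c\<bar>\<close>; in particular the inequality is an equality.
\<close>

lemma diff_entropy_cong_distr:
  assumes "distr P borel X = distr P borel Y"
  shows "diff_entropy P X = diff_entropy P Y"
proof -
  \<comment> \<open>\<open>distr\<close> uses only the sigma-algebra of its target measure, and
    \<open>lborel\<close> and \<open>borel\<close> share theirs.\<close>
  have "distr P lborel Z = distr P borel Z" for Z :: "'a \<Rightarrow> real"
    by (rule distr_cong) auto
  then show ?thesis
    using assms by (simp add: diff_entropy_def)
qed

text \<open>A partial converse to \<open>diff_entropy_distributed\<close>: finiteness excludes the
  singular case of the definition, so Radon-Nikodym yields a density, and \<open>f * ln f\<close> is
  integrable because the entropy density is integrable under the law of \<open>X\<close>.\<close>

lemma diff_entropy_finite_density: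
  assumes "prob_space P" and X: "X \<in> borel_measurable P"
    and fin: "\<bar>diff_entropy P X\<bar> \<noteq> \<infinity>"
  obtains f :: "real \<Rightarrow> real" where "distributed P lborel X (\<lambda>x. ennreal (f x))"
    "\<And>x. 0 \<le> f x" "integrable lborel (\<lambda>x. f x * ln (f x))"
proof -
  interpret prob_space P by fact
  let ?D = "distr P lborel X"
  let ?g = "entropy_density (exp 1) lborel ?D"
  have X' [measurable]: "X \<in> measurable P lborel"
    using X by simp
  interpret D: prob_space ?D
    by (rule prob_space_distr[OF X'])
  have ac: "absolutely_continuous lborel ?D"
    using fin by (auto simp: diff_entropy_def Let_def split: if_splits)
  \<comment> \<open>As \<infinity> - \<infinity> = \<infinity> in \<open>ereal\<close>, a finite
    difference leaves no room for an infinite term.\<close>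
  have *: "a \<noteq> \<infinity> \<and> b \<noteq> \<infinity>" if "\<bar>enn2ereal a - enn2ereal b\<bar> \<noteq> \<infinity>" for a b
    using that by (cases rule: ereal2_cases[of "enn2ereal a" "enn2ereal b"])
      (auto simp: top_ennreal.rep_eq)
  have "\<bar>enn2ereal (\<integral>\<^sup>+ x. ennreal (- ?g x) \<partial>?D) - enn2ereal (\<integral>\<^sup>+ x. ennreal (?g x) \<partial>?D)\<bar> \<noteq> \<infinity>"
    using fin ac by (simp add: diff_entropy_def Let_def)
  from *[OF this] have int: "integrable ?D ?g"
    by (auto simp: real_integrable_def)
  obtain f where f [measurable]: "f \<in> borel_measurable lborel"
    and RN: "AE x in lborel. RN_deriv lborel ?D x = ennreal (f x)"
    and nn: "\<And>x. 0 \<le> f x"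
    using sigma_finite_measure.real_RN_deriv[OF sigma_finite_lborel D.finite_measure_axioms ac] by auto
  have D: "?D = density lborel (\<lambda>x. ennreal (f x))"
    using sigma_finite_measure.density_RN_deriv[OF sigma_finite_lborel ac] density_cong[OF _ _ RN] by simp
  have "AE x in ?D. ?g x = ln (f x)"
    by (rule absolutely_continuous_AE[OF _ ac])
      (use RN nn in \<open>auto simp: entropy_density_def log_def\<close>)
  then have "integrable ?D (\<lambda>x. ln (f x))"
    using int by (subst (asm) integrable_cong_AE) auto
  then have "integrable lborel (\<lambda>x. f x * ln (f x))"
    unfolding D using nn by (subst (asm) integrable_density) auto
  moreover have "distributed P lborel X (\<lambda>x. ennreal (f x))"
    unfolding distributed_def using D X by simp
  ultimately show thesis
    using that nn by blast
qed

text \<open>\<open>c * X\<close> has density \<open>f (x / c) / \<bar>c\<bar>\<close>. The logarithm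
  splits off \<open>- ln \<bar>c\<bar>\<close>, which integrates to itself because \<open>f\<close>
  has total mass 1; the substitution x = c y handles the rest.\<close>

lemma diff_entropy_scale:
  fixes c :: real
  assumes "prob_space P" and X: "X \<in> borel_measurable P"
    and fin: "\<bar>diff_entropy P X\<bar> \<noteq> \<infinity>" and c: "c \<noteq> 0"
  shows "diff_entropy P (\<lambda>\<omega>. c * X \<omega>) = diff_entropy P X + ereal (ln \<bar>c\<bar>)"
proof -
  interpret prob_space P by fact
  obtain f :: "real \<Rightarrow> real" where dist: "distributed P lborel X (\<lambda>x. ennreal (f x))"
    and nn: "\<And>x. 0 \<le> f x" and int: "integrable lborel (\<lambda>x. f x * ln (f x))"
    using diff_entropy_finite_density[OF assms(1-3)] by blast
  have [measurable]: "f \<in> borel_measurable lborel"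
    using distributed_real_measurable[OF _ dist] nn by simp
  have "(\<integral>\<^sup>+x. ennreal (f x) \<partial>lborel) = ennreal 1"
    using distributed_nn_integral[OF dist, of "\<lambda>_. 1"] emeasure_space_1 by simp
  then have f: "has_bochner_integral lborel f 1"
    using nn by (intro has_bochner_integral_nn_integral) auto
  define g where "g x = f (x / c) / \<bar>c\<bar>" for x
  define F where "F x = f x * ln (f x) - ln \<bar>c\<bar> * f x" for x
  have F: "integrable lborel F" "integral\<^sup>L lborel F = (\<integral>x. f x * ln (f x) \<partial>lborel) - ln \<bar>c\<bar>"
    using int f unfolding F_def has_bochner_integral_iff by auto
  \<comment> \<open>The shape \<open>0 + 1 / c * x\<close> fits the affine change of variables for
    \<open>lborel\<close>. Where \<open>f\<close> vanishes, both sides are 0; elsewhere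
    \<open>ln_div\<close> applies.\<close>
  have gF: "g x * ln (g x) = \<bar>1 / c\<bar> * F (0 + 1 / c * x)" for x
    using nn[of "x / c"] c by (cases "f (x / c) = 0") (auto simp: g_def F_def ln_div field_simps)
  have "distributed P lborel (\<lambda>\<omega>. 0 + c * X \<omega>) (\<lambda>x. ennreal (f ((x - 0) / c)) / \<bar>c\<bar>)"
    by (rule distributed_affine[OF dist c])
  then have "distributed P lborel (\<lambda>\<omega>. c * X \<omega>) (\<lambda>x. ennreal (g x))"
    using nn c by (simp add: g_def divide_ennreal)
  moreover have "integrable lborel (\<lambda>x. g x * ln (g x))"
    unfolding gF using lborel_integrable_real_affine[OF F(1), of "1 / c" 0] c by auto
  moreover have "(\<integral>x. g x * ln (g x) \<partial>lborel) = integral\<^sup>L lborel F"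
    unfolding gF using lborel_integral_real_affine[of "1 / c" F 0] c by simp
  moreover have "0 \<le> g x" for x
    using nn by (simp add: g_def)
  ultimately have "diff_entropy P (\<lambda>\<omega>. c * X \<omega>) = ereal (- integral\<^sup>L lborel F)"
    using diff_entropy_distributed[OF assms(1), of "\<lambda>\<omega>. c * X \<omega>" g] by simp
  then show ?thesis
    using diff_entropy_distributed[OF assms(1) dist nn int] by (simp add: F)
qed

text \<open>Some orthogonal \<open>Q\<close> carries \<open>a\<close> to \<open>b\<close>, and
  \<open>a \<bullet> x = b \<bullet> (Q *v x)\<close>. Hence \<open>a \<bullet> v\<close> is
  \<open>b \<bullet> (Q *v v)\<close>, and \<open>Q *v v\<close> has the law of
  \<open>v\<close>.\<close>

lemma spherically_symmetric_inner_distr: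
  fixes a b :: "real ^ 'd"
  assumes "spherically_symmetric P v" and "norm a = norm b"
  shows "distr P borel (\<lambda>\<omega>. a \<bullet> v \<omega>) = distr P borel (\<lambda>\<omega>. b \<bullet> v \<omega>)"
proof -
  obtain f where f: "orthogonal_transformation f" "f a = b"
    using orthogonal_transformation_exists[OF assms(2)] .
  define Q where "Q = matrix f"
  have Q: "orthogonal_matrix Q" "f x = Q *v x" for x
    using f by (auto simp: Q_def orthogonal_transformation_matrix)
  have v [measurable]: "v \<in> borel_measurable P"
    and vQ: "distr P borel (\<lambda>\<omega>. Q *v v \<omega>) = distr P borel v"
    using assms(1) Q by (auto simp: spherically_symmetric_def)
  have [measurable]: "(\<lambda>x. Q *v x) \<in> borel_measurable borel"
    by (intro borel_measurable_continuous_onI) (auto intro: continuous_intros)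
  have "a \<bullet> x = b \<bullet> (Q *v x)" for x
    using f Q(2) by (metis orthogonal_transformation_def)
  then have "distr P borel (\<lambda>\<omega>. a \<bullet> v \<omega>) = distr (distr P borel (\<lambda>\<omega>. Q *v v \<omega>)) borel (\<lambda>x. b \<bullet> x)"
    by (subst distr_distr) (auto simp: comp_def)
  also have "\<dots> = distr P borel (\<lambda>\<omega>. b \<bullet> v \<omega>)"
    unfolding vQ by (subst distr_distr) (auto simp: comp_def)
  finally show ?thesis .
qed

lemma white_inner_moments:
  assumes "white P X"
  shows "integrable P (\<lambda>\<omega>. w \<bullet> X \<omega>)" "(\<integral>\<omega>. w \<bullet> X \<omega> \<partial>P) = 0"
    "(\<integral>\<omega>. (w \<bullet> X \<omega>)\<^sup>2 \<partial>P) = (norm w)\<^sup>2"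
proof -
  let ?C = "\<lambda>\<omega>. (\<chi> i j. X \<omega> $ i * X \<omega> $ j) :: real ^ 'b ^ 'b"
  have X: "integrable P X" "(\<integral>\<omega>. X \<omega> \<partial>P) = 0" and C: "integrable P ?C" "(\<integral>\<omega>. ?C \<omega> \<partial>P) = mat 1"
    using assms by (auto simp: white_def)
  show "integrable P (\<lambda>\<omega>. w \<bullet> X \<omega>)" "(\<integral>\<omega>. w \<bullet> X \<omega> \<partial>P) = 0"
    using X by auto
  \<comment> \<open>The square of \<open>w \<bullet> X\<close> is this linear functional applied to
    the matrix X X^T. In finite dimension it is bounded, so it commutes with the expectation, which
    is the identity matrix.\<close>
  have "linear (\<lambda>A. w \<bullet> (A *v w))"
    by (rule linearI) (simp_all add: matrix_vector_mult_add_rdistrib inner_add_right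
        scaleR_matrix_vector_assoc[symmetric])
  then have L: "bounded_linear (\<lambda>A :: real ^ 'b ^ 'b. w \<bullet> (A *v w))"
    by (rule linear_conv_bounded_linear[THEN iffD1])
  have "(w \<bullet> X \<omega>)\<^sup>2 = w \<bullet> (?C \<omega> *v w)" for \<omega>
    by (simp add: inner_vec_def matrix_vector_mult_def power2_eq_square sum_product
        sum_distrib_left mult_ac)
  then have "(\<integral>\<omega>. (w \<bullet> X \<omega>)\<^sup>2 \<partial>P) = w \<bullet> ((\<integral>\<omega>. ?C \<omega> \<partial>P) *v w)"
    using integral_bounded_linear[OF L C(1)] by simp
  then show "(\<integral>\<omega>. (w \<bullet> X \<omega>)\<^sup>2 \<partial>P) = (norm w)\<^sup>2"
    by (simp add: C power2_norm_eq_inner)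
qed

lemma white_elliptically_symmetric_inner_distr:
  fixes e :: "'a \<Rightarrow> real ^ 'd"
  assumes "prob_space P" and wh: "white P e" and ell: "elliptically_symmetric P e"
    and "norm w = 1" "norm w' = 1"
  shows "distr P borel (\<lambda>\<omega>. w \<bullet> e \<omega>) = distr P borel (\<lambda>\<omega>. w' \<bullet> e \<omega>)"
proof -
  interpret prob_space P by fact
  obtain \<mu> and \<Lambda> :: "real ^ 'd ^ 'd" and v where sph: "spherically_symmetric P v"
    and e: "\<And>\<omega>. \<omega> \<in> space P \<Longrightarrow> e \<omega> = \<mu> + \<Lambda> *v v \<omega>"
    using ell unfolding elliptically_symmetric_def by blast
  have [measurable]: "v \<in> borel_measurable P"
    using sph by (simp add: spherically_symmetric_def)
  \<comment> \<open>\<open>T u\<close> is \<Lambda>^T u, written as a row-vector product to match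
    \<open>dot_lmul_matrix\<close>.\<close>
  define T where "T u = u v* \<Lambda>" for u
  have we: "u \<bullet> e \<omega> = u \<bullet> \<mu> + T u \<bullet> v \<omega>" if "\<omega> \<in> space P" for u \<omega>
    using e[OF that] by (simp add: T_def inner_add_right dot_lmul_matrix)
  have Tv: "integrable P (\<lambda>\<omega>. T u \<bullet> v \<omega>)" for u
  proof -
    have "integrable P (\<lambda>\<omega>. u \<bullet> e \<omega> - u \<bullet> \<mu>)"
      using white_inner_moments(1)[OF wh] by auto
    then show ?thesis
      by (rule Bochner_Integration.integrable_cong[THEN iffD1, rotated -1]) (auto simp: we)
  qed
  \<comment> \<open>\<open>T u\<close> and \<open>- T u\<close> have equal norm, so
    \<open>T u \<bullet> v\<close> has a symmetric law and mean 0. Whiteness gives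
    \<open>u \<bullet> e\<close> mean 0 too, which leaves
    \<open>u \<bullet> \<mu> = 0\<close>.\<close>
  have centered: "u \<bullet> \<mu> = 0" for u
  proof -
    have "(\<integral>\<omega>. T u \<bullet> v \<omega> \<partial>P) = (\<integral>x. x \<partial>distr P borel (\<lambda>\<omega>. T u \<bullet> v \<omega>))"
      by (subst integral_distr) auto
    also have "\<dots> = (\<integral>x. x \<partial>distr P borel (\<lambda>\<omega>. (- T u) \<bullet> v \<omega>))"
      by (subst spherically_symmetric_inner_distr[OF sph, of "T u" "- T u"]) auto
    also have "\<dots> = - (\<integral>\<omega>. T u \<bullet> v \<omega> \<partial>P)"
      by (subst integral_distr) auto
    finally have "(\<integral>\<omega>. T u \<bullet> v \<omega> \<partial>P) = 0" by simp
    moreover have "0 = (\<integral>\<omega>. u \<bullet> \<mu> + T u \<bullet> v \<omega> \<partial>P)"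
      using white_inner_moments(2)[OF wh, of u] we
      by (metis (mono_tags, lifting) Bochner_Integration.integral_cong)
    ultimately show ?thesis
      using Tv by (simp add: prob_space)
  qed
  have we: "u \<bullet> e \<omega> = T u \<bullet> v \<omega>" if "\<omega> \<in> space P" for u \<omega>
    using we[OF that] centered by simp
  \<comment> \<open>An arbitrary coordinate: by symmetry, \<open>q\<close> is the second moment of
    \<open>v\<close> along every unit vector.\<close>
  define k where "k = (SOME k :: 'd. True)"
  define q where "q = (\<integral>\<omega>. (axis k 1 \<bullet> v \<omega>)\<^sup>2 \<partial>P)"
  have q: "(norm (T u))\<^sup>2 * q = (norm u)\<^sup>2" for u
  proof -
    let ?a = "norm (T u) *\<^sub>R axis k 1"
    have "(norm u)\<^sup>2 = (\<integral>\<omega>. (T u \<bullet> v \<omega>)\<^sup>2 \<partial>P)"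
      unfolding white_inner_moments(3)[OF wh, of u, symmetric]
      by (rule Bochner_Integration.integral_cong) (auto simp: we)
    also have "\<dots> = (\<integral>x. x\<^sup>2 \<partial>distr P borel (\<lambda>\<omega>. T u \<bullet> v \<omega>))"
      by (subst integral_distr) auto
    also have "\<dots> = (\<integral>x. x\<^sup>2 \<partial>distr P borel (\<lambda>\<omega>. ?a \<bullet> v \<omega>))"
      by (subst spherically_symmetric_inner_distr[OF sph, of "T u" ?a]) auto
    also have "\<dots> = (norm (T u))\<^sup>2 * q"
      by (subst integral_distr) (auto simp: q_def power_mult_distrib)
    finally show ?thesis ..
  qed
  \<comment> \<open>At a unit vector the identity \<open>q\<close> reads
    \<open>(norm (T w))\<^sup>2 * q = 1\<close>, so \<open>q\<close> is nonzero and can be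
    cancelled.\<close>
  have "(norm (T w))\<^sup>2 * q = (norm (T w'))\<^sup>2 * q" "q \<noteq> 0"
    using q[of w] q[of w'] assms by auto
  then have "norm (T w) = norm (T w')"
    by (simp add: power2_eq_iff_nonneg)
  then have "distr P borel (\<lambda>\<omega>. T w \<bullet> v \<omega>) = distr P borel (\<lambda>\<omega>. T w' \<bullet> v \<omega>)"
    by (rule spherically_symmetric_inner_distr[OF sph])
  moreover have "distr P borel (\<lambda>\<omega>. u \<bullet> e \<omega>) = distr P borel (\<lambda>\<omega>. T u \<bullet> v \<omega>)" for u
    by (rule distr_cong) (auto simp: we)
  ultimately show ?thesis by simp
qed

theorem proposition3:
  fixes P :: "'a measure" and M :: nat and s :: "nat \<Rightarrow> 'a \<Rightarrow> real ^ 'd"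
  assumes "prob_space P"
    and "ISA_sources P M s"
    and "\<And>m. m \<in> {1..M} \<Longrightarrow> elliptically_symmetric P (s m)"
  shows "\<forall>m\<in>{1..M}.
     (\<forall>w\<in>sphere (0 :: real ^ 'd) 1.
        diff_entropy P (\<lambda>\<omega>. \<Sum>i\<in>UNIV. w $ i * s m \<omega> $ i)
          \<ge> (\<Sum>i\<in>UNIV. ereal ((w $ i)\<^sup>2) * diff_entropy P (\<lambda>\<omega>. s m \<omega> $ i))) \<and>
     (\<forall>w\<in>sphere (0 :: real ^ 'd) 1.
        exp_ereal (2 * diff_entropy P (\<lambda>\<omega>. \<Sum>i\<in>UNIV. w $ i * s m \<omega> $ i))
          = (\<Sum>i\<in>UNIV. exp_ereal (2 * diff_entropy P (\<lambda>\<omega>. w $ i * s m \<omega> $ i))))"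
proof
  fix m assume m: "m \<in> {1..M}"
  let ?H = "diff_entropy P"
  have wh: "white P (s m)" and fin: "\<And>i. \<bar>?H (\<lambda>\<omega>. s m \<omega> $ i)\<bar> \<noteq> \<infinity>"
    using assms(2) m by (auto simp: ISA_sources_def)
  have meas: "(\<lambda>\<omega>. s m \<omega> $ i) \<in> borel_measurable P" for i
    using borel_measurable_integrable[OF white_inner_moments(1)[OF wh, of "axis i 1"]]
    by (simp add: inner_axis')
  have H_eq: "?H (\<lambda>\<omega>. w \<bullet> s m \<omega>) = ?H (\<lambda>\<omega>. w' \<bullet> s m \<omega>)" if "norm w = 1" "norm w' = 1" for w w'
    by (intro diff_entropy_cong_distr white_elliptically_symmetric_inner_distr
        assms(1) assms(3)[OF m] wh that)
  \<comment> \<open>\<open>undefined\<close> serves as an arbitrary coordinate; the finite entropy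
    \<open>h\<close> found there is that of every unit projection.\<close>
  obtain h where h: "?H (\<lambda>\<omega>. axis undefined 1 \<bullet> s m \<omega>) = ereal h"
    using fin[of undefined] by (auto simp: inner_axis')
  have H_unit: "?H (\<lambda>\<omega>. \<Sum>i\<in>UNIV. w $ i * s m \<omega> $ i) = ereal h" if "norm w = 1" for w
    using H_eq[OF that, of "axis undefined 1"] h by (simp add: inner_vec_def)
  have H_coord: "?H (\<lambda>\<omega>. s m \<omega> $ i) = ereal h" for i
    using H_eq[of "axis i 1" "axis undefined 1"] h by (simp add: inner_axis')
  \<comment> \<open>For \<open>c = 0\<close> the entropy of the constant is -\<infinity> and
    \<open>exp_ereal\<close> sends it to 0, in agreement with the factor \<open>c\<^sup>2\<close>.
    Otherwise scaling adds \<open>ln \<bar>c\<bar>\<close>, and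
    \<open>exp (2 * ln \<bar>c\<bar>)\<close> is \<open>c\<^sup>2\<close>.\<close>
  have exp_H: "exp_ereal (2 * ?H (\<lambda>\<omega>. c * s m \<omega> $ i)) = ereal (c\<^sup>2 * exp (2 * h))" for c i
  proof (cases "c = 0")
    case True
    then show ?thesis
      by (simp add: diff_entropy_const[OF assms(1)])
  next
    case False
    then have "exp (2 * (h + ln \<bar>c\<bar>)) = c\<^sup>2 * exp (2 * h)"
      by (simp add: distrib_left exp_add exp_double power2_eq_square)
    then show ?thesis
      using diff_entropy_scale[OF assms(1) meas fin False] H_coord by simp
  qed
  have norm: "(\<Sum>i\<in>UNIV. (w $ i)\<^sup>2) = 1" if "norm w = 1" for w :: "real ^ 'd"
    using that by (simp add: norm_vec_def L2_set_def)
  show "(\<forall>w\<in>sphere (0 :: real ^ 'd) 1.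
        ?H (\<lambda>\<omega>. \<Sum>i\<in>UNIV. w $ i * s m \<omega> $ i)
          \<ge> (\<Sum>i\<in>UNIV. ereal ((w $ i)\<^sup>2) * ?H (\<lambda>\<omega>. s m \<omega> $ i))) \<and>
     (\<forall>w\<in>sphere (0 :: real ^ 'd) 1.
        exp_ereal (2 * ?H (\<lambda>\<omega>. \<Sum>i\<in>UNIV. w $ i * s m \<omega> $ i))
          = (\<Sum>i\<in>UNIV. exp_ereal (2 * ?H (\<lambda>\<omega>. w $ i * s m \<omega> $ i))))"
    \<comment> \<open>Factoring out \<open>h\<close>, respectively \<open>exp (2 * h)\<close>,
      leaves the sum of the \<open>(w $ i)\<^sup>2\<close>, which is 1.\<close>
    unfolding exp_H by (auto simp: H_unit H_coord norm simp flip: sum_distrib_right)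
qed

end
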